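(* Let $\rho\in(0,2)$ and $\sigma>0$. Suppose that the KKT solution set $\bar\Omega$ is nonempty, and that $\Sigma_f+\mathcal S+\sigma\mathcal A\mathcal A^*$ and $\Sigma_g+\mathcal T+\sigma\mathcal B\mathcal B^*$ are positive definite. Let $\{u^k\}=\{(y^k,z^k,x^k)\}$ be a sequence generated by sPGADMM. Then the sequence $\{(y^k,z^k)\}$ converges to an optimal solution of the problem $$\min_{y\in\mathcal Y,\,z\in\mathcal Z}\ f(y)+g(z)\quad\text{s.t.}\quad\mathcal A^*y+\mathcal B^*z=c,$$ and $\{x^k\}$ converges to an optimal solution of the corresponding (Lagrangian) dual problem.
   Context: Setting. $\mathcal X$, $\mathcal Y=\mathcal Y_1\times\cdots\times\mathcal Y_m$, $\mathcal Z=\mathcal Z_1\times\cdots\times\mathcal Z_n$ are finite-dimensional real Euclidean spaces with inner product $\langle\cdot,\cdot\rangle$ and induced norm $\|\cdot\|$. $\mathcal A:\mathcal X\to\mathcal Y$, $\mathcal B:\mathcal X\to\mathcal Z$ are linear with adjoints $\mathcal A^*,\mathcal B^*$, and $c\in\mathcal X$. $f:\mathcal Y\to(-\infty,+\infty]$, $g:\mathcal Z\to(-\infty,+\infty]$ are closed proper convex functions of the form $f(y)=f_1(y_1)+f_2(y)$, $g(z)=g_1(z_1)+g_2(z)$ with $f_1:\mathcal Y_1\to(-\infty,+\infty]$, $g_1:\mathcal Z_1\to(-\infty,+\infty]$ closed proper convex and $f_2:\mathcal Y\to\mathbb R$, $g_2:\mathcal Z\to\mathbb R$ convex quadratic. The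 dual problem associated with the Lagrangian $f(y)+g(z)-\langle x,\mathcal A^*y+\mathcal B^*z-c\rangle$ is $\max_{x\in\mathcal X}\ \langle c,x\rangle-f^\star(\mathcal Ax)-g^\star(\mathcal Bx)$, with $f^\star,g^\star$ the Fenchel conjugates. $\Sigma_f$ and $\Sigma_g$ are self-adjoint positive semidefinite operators on $\mathcal Y$ and $\mathcal Z$ such that $\langle\xi'-\xi,y'-y\rangle\ge\|y'-y\|_{\Sigma_f}^2$ for all $y,y'\in\mathrm{dom}(f)$, $\xi\in\partial f(y)$, $\xi'\in\partial f(y')$, and $\langle\zeta'-\zeta,z'-z\rangle\ge\|z'-z\|_{\Sigma_g}^2$ for all $z,z'\in\mathrm{dom}(g)$, $\zeta\in\partial g(z)$, $\zeta'\in\partial g(z')$. For a self-adjoint positive semidefinite $\mathcal G$, $\|v\|_{\mathcal G}:=\sqrt{\langle v,\mathcal Gv\rangle}$. $\bar\Omega$ is the set of $(\bar y,\bar z,\bar x)\in\mathcal Y\times\mathcal Z\times\mathcal X$ with $\mathcal A\bar x\in\partial f(\bar y)$, $\mathcal B\bar x\in\partial g(\bar z)$, $\mathcal A^*\bar y+\mathcal B^*\bar z-c=0$ (KKT points). Algorithm sPGADMM. Let $\sigma>0$, $\rho\in(0,2)$, and let $\mathcal S:\mathcal Y\to\mathcal Y$, $\mathcal T:\mathcal Z\to\mathcal Z$ be self-adjoint positive semidefinite linear operators. From $(y^0,z^0,x^0)\in\mathrm{dom}(f)\times\mathrm{dom}(g)\times\mathcal X$, for $k=0,1,2,\dots$: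 $y^{k+1}$ minimizes over $y\in\mathcal Y$: $f(y)-\langle\mathcal Ax^k,y\rangle+\frac\sigma2\|\mathcal A^*y+\mathcal B^*z^k-c\|^2+\frac12\|y-y^k\|_{\mathcal S}^2$; $z^{k+1}$ minimizes over $z\in\mathcal Z$: $g(z)-\langle\mathcal Bx^k,z\rangle+\frac\sigma2\|\rho(\mathcal A^*y^{k+1}+\mathcal B^*z^k-c)+\mathcal B^*(z-z^k)\|^2+\frac12\|z-z^k\|_{\mathcal T}^2$; $x^{k+1}:=x^k-\sigma\big(\rho(\mathcal A^*y^{k+1}+\mathcal B^*z^k-c)+\mathcal B^*(z^{k+1}-z^k)\big)$. *)

theory Defs
  imports "HOL-Analysis.Analysis"
begin

(* Y 1, ..., Y m are subspaces of one common ambient Euclidean space (their dimensions may differ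
   and may be 0), and the coordinate maps pr 1, ..., pr m identify the inner product space 'v
   with the product Y 1 \<times> ... \<times> Y m. *)
definition is_product_of ::
  "nat \<Rightarrow> (nat \<Rightarrow> 'e::euclidean_space set) \<Rightarrow> (nat \<Rightarrow> 'v::euclidean_space \<Rightarrow> 'e) \<Rightarrow> bool"
where
  "is_product_of m Y pr \<longleftrightarrow>
     (\<forall>i\<in>{1..m}. subspace (Y i) \<and> linear (pr i)) \<and>
     bij_betw (\<lambda>v. \<lambda>i\<in>{1..m}. pr i v) UNIV (\<Pi>\<^sub>E i\<in>{1..m}. Y i) \<and>
     (\<forall>v w. v \<bullet> w = (\<Sum>i=1..m. pr i v \<bullet> pr i w))"

definition ereal_epigraph :: "'a set \<Rightarrow> ('a \<Rightarrow> ereal) \<Rightarrow> ('a \<times> real) set" where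
  "ereal_epigraph S h = {(v, r). v \<in> S \<and> h v \<le> ereal r}"

definition closed_proper_convex_on :: "'a::euclidean_space set \<Rightarrow> ('a \<Rightarrow> ereal) \<Rightarrow> bool" where
  "closed_proper_convex_on S h \<longleftrightarrow>
     closed (ereal_epigraph S h) \<and> convex (ereal_epigraph S h) \<and>
     (\<forall>v\<in>S. h v \<noteq> -\<infinity>) \<and> (\<exists>v\<in>S. h v < \<infinity>)"

definition self_adjoint :: "('a::euclidean_space \<Rightarrow> 'a) \<Rightarrow> bool" where
  "self_adjoint G \<longleftrightarrow> linear G \<and> adjoint G = G"

definition pos_semidef :: "('a::euclidean_space \<Rightarrow> 'a) \<Rightarrow> bool" where
  "pos_semidef G \<longleftrightarrow> self_adjoint G \<and> (\<forall>v. 0 \<le> v \<bullet> G v)"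

definition pos_def :: "('a::euclidean_space \<Rightarrow> 'a) \<Rightarrow> bool" where
  "pos_def G \<longleftrightarrow> self_adjoint G \<and> (\<forall>v. v \<noteq> 0 \<longrightarrow> 0 < v \<bullet> G v)"

definition op_norm :: "('a::euclidean_space \<Rightarrow> 'a) \<Rightarrow> 'a \<Rightarrow> real" where
  "op_norm G v = sqrt (v \<bullet> G v)"

definition convex_quadratic :: "('a::euclidean_space \<Rightarrow> real) \<Rightarrow> bool" where
  "convex_quadratic q \<longleftrightarrow>
     (\<exists>Q b r. self_adjoint Q \<and> (\<forall>v. q v = 1/2 * (v \<bullet> Q v) + b \<bullet> v + r)) \<and> convex_on UNIV q"

definition edom :: "('a \<Rightarrow> ereal) \<Rightarrow> 'a set" where
  "edom h = {v. h v < \<infinity>}"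

(* For proper h this set is empty whenever h v = \<infinity>. *)
definition subdifferential :: "('a::euclidean_space \<Rightarrow> ereal) \<Rightarrow> 'a \<Rightarrow> 'a set" where
  "subdifferential h v = {\<xi>. \<forall>w. h v + ereal (\<xi> \<bullet> (w - v)) \<le> h w}"

definition fenchel_conjugate :: "('a::euclidean_space \<Rightarrow> ereal) \<Rightarrow> 'a \<Rightarrow> ereal" where
  "fenchel_conjugate h \<xi> = (SUP v. ereal (\<xi> \<bullet> v) - h v)"

definition monotone_modulus ::
  "('a::euclidean_space \<Rightarrow> ereal) \<Rightarrow> ('a \<Rightarrow> 'a) \<Rightarrow> bool" where
  "monotone_modulus h \<Sigma> \<longleftrightarrow>
     (\<forall>v\<in>edom h. \<forall>v'\<in>edom h. \<forall>\<xi>\<in>subdifferential h v. \<forall>\<xi>'\<in>subdifferential h v'.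
        (\<xi>' - \<xi>) \<bullet> (v' - v) \<ge> (op_norm \<Sigma> (v' - v))\<^sup>2)"

definition KKT_points ::
  "('y::euclidean_space \<Rightarrow> ereal) \<Rightarrow> ('z::euclidean_space \<Rightarrow> ereal) \<Rightarrow>
   ('x::euclidean_space \<Rightarrow> 'y) \<Rightarrow> ('x \<Rightarrow> 'z) \<Rightarrow> 'x \<Rightarrow> ('y \<times> 'z \<times> 'x) set"
where
  "KKT_points f g A B c =
     {(y, z, x). A x \<in> subdifferential f y \<and> B x \<in> subdifferential g z \<and>
                 adjoint A y + adjoint B z - c = 0}"

(* An optimal solution has to be feasible with finite objective value: minimisation is over
   edom f \<times> edom g, and maximisation below over the points where the dual objective is
   not -\<infinity>. *)
definition primal_optimal ::
  "('y::euclidean_space \<Rightarrow> ereal) \<Rightarrow> ('z::euclidean_space \<Rightarrow> ereal) \<Rightarrow>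
   ('x::euclidean_space \<Rightarrow> 'y) \<Rightarrow> ('x \<Rightarrow> 'z) \<Rightarrow> 'x \<Rightarrow> 'y \<times> 'z \<Rightarrow> bool"
where
  "primal_optimal f g A B c =
     is_arg_min (\<lambda>(y, z). f y + g z)
       (\<lambda>(y, z). y \<in> edom f \<and> z \<in> edom g \<and> adjoint A y + adjoint B z = c)"

definition dual_objective ::
  "('y::euclidean_space \<Rightarrow> ereal) \<Rightarrow> ('z::euclidean_space \<Rightarrow> ereal) \<Rightarrow>
   ('x::euclidean_space \<Rightarrow> 'y) \<Rightarrow> ('x \<Rightarrow> 'z) \<Rightarrow> 'x \<Rightarrow> 'x \<Rightarrow> ereal"
where
  "dual_objective f g A B c x =
     ereal (c \<bullet> x) - fenchel_conjugate f (A x) - fenchel_conjugate g (B x)"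

definition dual_optimal ::
  "('y::euclidean_space \<Rightarrow> ereal) \<Rightarrow> ('z::euclidean_space \<Rightarrow> ereal) \<Rightarrow>
   ('x::euclidean_space \<Rightarrow> 'y) \<Rightarrow> ('x \<Rightarrow> 'z) \<Rightarrow> 'x \<Rightarrow> 'x \<Rightarrow> bool"
where
  "dual_optimal f g A B c =
     is_arg_max (dual_objective f g A B c) (\<lambda>x. dual_objective f g A B c x \<noteq> -\<infinity>)"

definition sPGADMM_sequence ::
  "('y::euclidean_space \<Rightarrow> ereal) \<Rightarrow> ('z::euclidean_space \<Rightarrow> ereal) \<Rightarrow>
   ('x::euclidean_space \<Rightarrow> 'y) \<Rightarrow> ('x \<Rightarrow> 'z) \<Rightarrow> 'x \<Rightarrow> real \<Rightarrow> real \<Rightarrow> ('y \<Rightarrow> 'y) \<Rightarrow> ('z \<Rightarrow> 'z) \<Rightarrow>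
   (nat \<Rightarrow> 'y) \<Rightarrow> (nat \<Rightarrow> 'z) \<Rightarrow> (nat \<Rightarrow> 'x) \<Rightarrow> bool"
where
  "sPGADMM_sequence f g A B c \<sigma> \<rho> S T y z x \<longleftrightarrow>
     y 0 \<in> edom f \<and> z 0 \<in> edom g \<and>
     (\<forall>k.
        is_arg_min
          (\<lambda>v. f v + ereal (- (A (x k) \<bullet> v)
                 + \<sigma> / 2 * (norm (adjoint A v + adjoint B (z k) - c))\<^sup>2
                 + 1 / 2 * (op_norm S (v - y k))\<^sup>2))
          (\<lambda>_. True) (y (Suc k)) \<and>
        is_arg_min
          (\<lambda>w. g w + ereal (- (B (x k) \<bullet> w)
                 + \<sigma> / 2 * (norm (\<rho> *\<^sub>R (adjoint A (y (Suc k)) + adjoint B (z k) - c)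
                                   + adjoint B (w - z k)))\<^sup>2
                 + 1 / 2 * (op_norm T (w - z k))\<^sup>2))
          (\<lambda>_. True) (z (Suc k)) \<and>
        x (Suc k) = x k - \<sigma> *\<^sub>R (\<rho> *\<^sub>R (adjoint A (y (Suc k)) + adjoint B (z k) - c)
                                  + adjoint B (z (Suc k) - z k)))"

end

theory Submission
  imports Defs
begin

text \<open>The iteration has one quantity that moves by a multiple of the primal residual alone. Put
  \<open>r k = A\<^sup>* y (k+1) + B\<^sup>* z k - c\<close>; the multiplier update says that \<open>x + \<sigma> B\<^sup>* z\<close> changes by
  \<open>- \<sigma> \<rho> r k\<close>. The two subproblems give \<open>A (x k - \<sigma> r k) - S (y (k+1) - y k) \<in> \<partial>f (y (k+1))\<close> and
  \<open>B (x k) - T (z k - z (k-1)) \<in> \<partial>g (z k)\<close>. Compare these with a KKT point, write \<open>s k\<close> for the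
  error of \<open>x + \<sigma> B\<^sup>* z\<close>, and add: strong monotonicity bounds \<open>s k \<bullet> r k - \<sigma> |r k|\<^sup>2\<close> from
  below by the two moduli plus proximal terms that telescope. Inserted into the expansion of
  \<open>|s k - \<sigma> \<rho> r k|\<^sup>2\<close> this shows (lemma \<open>energy_decrease\<close>) that the energy
  \<open>|s k|\<^sup>2 / (\<sigma> \<rho>) + |y k - yb|\<^sub>S\<^sup>2 + |z (k-1) - zb|\<^sub>T\<^sup>2\<close> decreases by at least
  \<open>\<sigma> (2 - \<rho>) |r k|\<^sup>2\<close> plus the squared increments of \<open>y\<close> and \<open>z\<close> in the seminorms of \<open>S\<close> and \<open>T\<close>
  plus twice the squared errors in the seminorms of the moduli; here \<open>\<rho> < 2\<close> enters.

  The energy also dominates all errors (\<open>error_le_energy\<close>). Monotonicity of \<open>\<partial>g\<close> makes the inner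
  product of \<open>x - xb\<close> and \<open>B\<^sup>* (z - zb)\<close> almost nonnegative, so the energy bounds both of them; the
  residual then bounds \<open>A\<^sup>* (y - yb)\<close>, and positive definiteness of the two operators turns these
  bounds into bounds on \<open>y - yb\<close> and \<open>z - zb\<close>.

  Hence the iterates are bounded, and the vanishing of the residual and of the increments makes a
  cluster point satisfy the KKT conditions (\<open>cluster_point_KKT\<close>). The energy around that
  cluster point is decreasing and tends to 0 along a subsequence, hence tends to 0, and with it all
  errors. Finally, KKT points consist of primal and dual solutions by convex duality.\<close>

section \<open>Subgradients of closed proper convex functions\<close>

lemma cpc_not_MInf: "closed_proper_convex_on UNIV h \<Longrightarrow> h v \<noteq> -\<infinity>"
  by (simp add: closed_proper_convex_on_def)

lemma cpc_subdifferential_finite: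
  assumes "closed_proper_convex_on UNIV h" and "\<xi> \<in> subdifferential h v"
  shows "\<bar>h v\<bar> \<noteq> \<infinity>"
proof -
  obtain w where w: "h w < \<infinity>"
    using assms(1) by (auto simp: closed_proper_convex_on_def)
  have "h v + ereal (\<xi> \<bullet> (w - v)) \<le> h w"
    using assms(2) by (simp add: subdifferential_def)
  with w have "h v \<noteq> \<infinity>" by auto
  with cpc_not_MInf[OF assms(1), of v] show ?thesis by auto
qed

lemma subdifferential_in_edom:
  assumes "closed_proper_convex_on UNIV h" and "\<xi> \<in> subdifferential h v"
  shows "v \<in> edom h"
  using cpc_subdifferential_finite[OF assms] by (auto simp: edom_def)

text \<open>The epigraph is convex, so along the segment from the minimiser \<open>u\<close> to any \<open>w\<close> the increase of
  \<open>h\<close> is at most linear in \<open>t\<close>; minimality compares it with \<open>t (l \<bullet> (w - u)) + O(t\<^sup>2)\<close>, and letting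
  \<open>t\<close> tend to 0 gives the subgradient inequality.\<close>
lemma minimizer_plus_quadratic_subgradient:
  fixes h :: "'a::euclidean_space \<Rightarrow> ereal"
  assumes cpc: "closed_proper_convex_on UNIV h"
    and min: "is_arg_min (\<lambda>v. h v + ereal (q v)) (\<lambda>_. True) u"
    and quad: "\<And>d t. q (u + t *\<^sub>R d) = q u + t * (l \<bullet> d) + t\<^sup>2 * M d"
  shows "- l \<in> subdifferential h u"
proof -
  have le: "h u + ereal (q u) \<le> h w + ereal (q w)" for w
    using min by (auto simp: is_arg_min_def not_less)
  obtain w0 where "h w0 < \<infinity>"
    using cpc by (auto simp: closed_proper_convex_on_def)
  with le[of w0] have "h u \<noteq> \<infinity>" by auto
  then obtain a where a: "h u = ereal a"
    using cpc_not_MInf[OF cpc, of u] by (cases "h u") auto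
  have "h u + ereal ((- l) \<bullet> (w - u)) \<le> h w" for w
  proof (cases "h w")
    case (real b)
    have main: "a - b \<le> l \<bullet> (w - u) + t * M (w - u)" if t: "0 < t" "t < 1" for t
    proof -
      have "(1 - t) *\<^sub>R (u, a) + t *\<^sub>R (w, b) \<in> ereal_epigraph UNIV h"
        using cpc t real a unfolding closed_proper_convex_on_def
        by (intro convexD) (auto simp: ereal_epigraph_def)
      moreover have "(1 - t) *\<^sub>R u + t *\<^sub>R w = u + t *\<^sub>R (w - u)"
        by (simp add: algebra_simps)
      ultimately have "h (u + t *\<^sub>R (w - u)) \<le> ereal ((1 - t) * a + t * b)"
        by (simp add: ereal_epigraph_def)
      then have "h (u + t *\<^sub>R (w - u)) + ereal (q (u + t *\<^sub>R (w - u)))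
          \<le> ereal ((1 - t) * a + t * b) + ereal (q (u + t *\<^sub>R (w - u)))"
        by (rule add_right_mono)
      with le[of "u + t *\<^sub>R (w - u)"]
      have "a + q u \<le> (1 - t) * a + t * b + q (u + t *\<^sub>R (w - u))"
        unfolding a using order_trans by fastforce
      then have "t * (a - b) \<le> t * (l \<bullet> (w - u) + t * M (w - u))"
        unfolding quad by (simp add: algebra_simps power2_eq_square)
      with t show ?thesis by simp
    qed
    have "((\<lambda>t. l \<bullet> (w - u) + t * M (w - u)) \<longlongrightarrow> l \<bullet> (w - u) + 0 * M (w - u)) (at_right 0)"
      by (intro tendsto_intros)
    moreover have "\<forall>\<^sub>F t in at_right 0. a - b \<le> l \<bullet> (w - u) + t * M (w - u)"
      by (rule eventually_at_rightI[of 0 1]) (use main in auto)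
    ultimately have "a - b \<le> l \<bullet> (w - u) + 0 * M (w - u)"
      by (rule tendsto_lowerbound) simp
    then show ?thesis using real a by simp
  qed (use cpc_not_MInf[OF cpc, of w] in auto)
  then show ?thesis by (simp add: subdifferential_def)
qed

text \<open>A closed epigraph makes the graph of the subdifferential closed: the points
  \<open>(v k, h w - \<xi> k \<bullet> (w - v k))\<close> lie in the epigraph for every fixed \<open>w\<close> in the domain.\<close>
lemma subdifferential_closed_graph:
  fixes h :: "'a::euclidean_space \<Rightarrow> ereal"
  assumes cpc: "closed_proper_convex_on UNIV h"
    and sub: "\<And>k. \<xi> k \<in> subdifferential h (v k)"
    and lim: "v \<longlonglongrightarrow> v'" "\<xi> \<longlonglongrightarrow> \<xi>'"
  shows "\<xi>' \<in> subdifferential h v'"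
proof -
  have closed: "closed (ereal_epigraph UNIV h)"
    using cpc by (simp add: closed_proper_convex_on_def)
  have "h v' + ereal (\<xi>' \<bullet> (w - v')) \<le> h w" for w
  proof (cases "h w")
    case (real b)
    have "(v k, b - \<xi> k \<bullet> (w - v k)) \<in> ereal_epigraph UNIV h" for k
    proof -
      have "h (v k) + ereal (\<xi> k \<bullet> (w - v k)) \<le> ereal b"
        using sub[of k] real by (auto simp: subdifferential_def dest: spec[of _ w])
      then show ?thesis by (cases "h (v k)") (auto simp: ereal_epigraph_def)
    qed
    moreover have "(\<lambda>k. (v k, b - \<xi> k \<bullet> (w - v k))) \<longlonglongrightarrow> (v', b - \<xi>' \<bullet> (w - v'))"
      by (intro tendsto_intros lim)
    ultimately have "(v', b - \<xi>' \<bullet> (w - v')) \<in> ereal_epigraph UNIV h"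
      by (rule closed_sequentially[OF closed])
    then show ?thesis using real by (cases "h v'") (auto simp: ereal_epigraph_def)
  qed (use cpc_not_MInf[OF cpc, of w] in auto)
  then show ?thesis by (simp add: subdifferential_def)
qed

section \<open>Optimality of KKT points\<close>

lemma KKT_imp_primal_optimal:
  fixes A :: "'x::euclidean_space \<Rightarrow> 'y::euclidean_space"
    and B :: "'x \<Rightarrow> 'z::euclidean_space"
  assumes f: "closed_proper_convex_on UNIV f" and g: "closed_proper_convex_on UNIV g"
    and A: "linear A" and B: "linear B"
    and kkt: "(y, z, x) \<in> KKT_points f g A B c"
  shows "primal_optimal f g A B c (y, z)"
proof -
  have sf: "A x \<in> subdifferential f y" and sg: "B x \<in> subdifferential g z"
    and feas: "adjoint A y + adjoint B z = c"
    using kkt by (auto simp: KKT_points_def)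
  have "f y + g z \<le> f y' + g z'" if feas': "adjoint A y' + adjoint B z' = c" for y' z'
  proof -
    have "A x \<bullet> (y' - y) + B x \<bullet> (z' - z)
        = x \<bullet> (adjoint A y' + adjoint B z') - x \<bullet> (adjoint A y + adjoint B z)"
      by (simp add: inner_diff_right inner_add_right adjoint_works[OF A] adjoint_works[OF B])
    then have 0: "A x \<bullet> (y' - y) + B x \<bullet> (z' - z) = 0" by (simp add: feas feas')
    have "f y + ereal (A x \<bullet> (y' - y)) + (g z + ereal (B x \<bullet> (z' - z))) \<le> f y' + g z'"
      using sf sg by (intro add_mono) (auto simp: subdifferential_def)
    moreover have "f y + ereal (A x \<bullet> (y' - y)) + (g z + ereal (B x \<bullet> (z' - z))) = f y + g z"
      using cpc_subdifferential_finite[OF f sf] cpc_subdifferential_finite[OF g sg] 0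
      by (cases "f y"; cases "g z") auto
    ultimately show ?thesis by simp
  qed
  then show ?thesis
    using subdifferential_in_edom[OF f sf] subdifferential_in_edom[OF g sg] feas
    by (auto simp: primal_optimal_def is_arg_min_def not_less)
qed

lemma fenchel_young: "ereal (\<xi> \<bullet> v) - h v \<le> fenchel_conjugate h \<xi>"
  unfolding fenchel_conjugate_def by (rule SUP_upper) simp

lemma fenchel_conjugate_eq:
  assumes h: "closed_proper_convex_on UNIV h" and sub: "\<xi> \<in> subdifferential h v"
  shows "fenchel_conjugate h \<xi> = ereal (\<xi> \<bullet> v) - h v"
proof (rule antisym)
  obtain a where a: "h v = ereal a"
    using cpc_subdifferential_finite[OF assms] by (cases "h v") auto
  have "ereal (\<xi> \<bullet> w) - h w \<le> ereal (\<xi> \<bullet> v) - h v" for w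
  proof -
    have "h v + ereal (\<xi> \<bullet> (w - v)) \<le> h w"
      using sub by (simp add: subdifferential_def)
    then show ?thesis by (cases "h w") (auto simp: a inner_diff_right)
  qed
  then show "fenchel_conjugate h \<xi> \<le> ereal (\<xi> \<bullet> v) - h v"
    unfolding fenchel_conjugate_def by (intro SUP_least)
qed (rule fenchel_young)

text \<open>By the Fenchel-Young inequality and feasibility of \<open>(y, z)\<close> no dual value exceeds
  \<open>f y + g z\<close>, and the two subgradient conditions say that \<open>x\<close> attains equality.\<close>
lemma KKT_imp_dual_optimal:
  fixes A :: "'x::euclidean_space \<Rightarrow> 'y::euclidean_space"
    and B :: "'x \<Rightarrow> 'z::euclidean_space"
  assumes f: "closed_proper_convex_on UNIV f" and g: "closed_proper_convex_on UNIV g"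
    and A: "linear A" and B: "linear B"
    and kkt: "(y, z, x) \<in> KKT_points f g A B c"
  shows "dual_optimal f g A B c x"
proof -
  have sf: "A x \<in> subdifferential f y" and sg: "B x \<in> subdifferential g z"
    and feas: "adjoint A y + adjoint B z = c"
    using kkt by (auto simp: KKT_points_def)
  obtain a where a: "f y = ereal a"
    using cpc_subdifferential_finite[OF f sf] by (cases "f y") auto
  obtain b where b: "g z = ereal b"
    using cpc_subdifferential_finite[OF g sg] by (cases "g z") auto
  have c: "c \<bullet> x' = A x' \<bullet> y + B x' \<bullet> z" for x'
  proof -
    have "c \<bullet> x' = x' \<bullet> (adjoint A y + adjoint B z)" by (simp add: feas inner_commute)
    then show ?thesis by (simp add: inner_add_right adjoint_works[OF A] adjoint_works[OF B])
  qed
  have val: "dual_objective f g A B c x = ereal (a + b)"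
    by (simp add: dual_objective_def fenchel_conjugate_eq[OF f sf] fenchel_conjugate_eq[OF g sg] a b c)
  have "dual_objective f g A B c x' \<le> ereal (a + b)" for x'
    using fenchel_young[of "A x'" y f] fenchel_young[of "B x'" z g]
    by (cases "fenchel_conjugate f (A x')"; cases "fenchel_conjugate g (B x')")
      (auto simp: dual_objective_def a b c)
  then show ?thesis
    by (auto simp: dual_optimal_def is_arg_max_def val not_less)
qed

section \<open>Quadratic forms of semidefinite operators\<close>

lemma pos_semidef_linear: "pos_semidef G \<Longrightarrow> linear G"
  by (simp add: pos_semidef_def self_adjoint_def)

lemma pos_semidef_sym:
  assumes "pos_semidef G"
  shows "u \<bullet> G v = v \<bullet> G u"
  using assms adjoint_works[of G v u] by (simp add: pos_semidef_def self_adjoint_def inner_commute)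

lemma pos_semidef_nonneg: "pos_semidef G \<Longrightarrow> 0 \<le> v \<bullet> G v"
  by (simp add: pos_semidef_def)

lemma op_norm_square: "pos_semidef G \<Longrightarrow> (op_norm G v)\<^sup>2 = v \<bullet> G v"
  by (simp add: op_norm_def pos_semidef_nonneg)

lemma pos_semidef_three_point:
  assumes G: "pos_semidef G"
  shows "2 * (G (u - v) \<bullet> u) = u \<bullet> G u - v \<bullet> G v + (u - v) \<bullet> G (u - v)"
  using pos_semidef_sym[OF G, of u v]
  by (simp add: linear_diff[OF pos_semidef_linear[OF G]] inner_diff_left inner_diff_right inner_commute)

text \<open>Expanding the nonnegative form at \<open>v - t G v\<close> gives \<open>2 t |G v|\<^sup>2 \<le> v \<bullet> G v + t\<^sup>2 K |G v|\<^sup>2\<close>, where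
  \<open>K\<close> bounds \<open>G\<close>; the choice \<open>t = 1 / K\<close> is optimal.\<close>
lemma pos_semidef_norm_bound:
  assumes G: "pos_semidef G"
  obtains K where "K > 0" and "\<And>v. (norm (G v))\<^sup>2 \<le> K * (v \<bullet> G v)"
proof -
  have lin: "linear G" by (rule pos_semidef_linear[OF G])
  obtain K where K: "K > 0" "\<And>v. norm (G v) \<le> K * norm v"
    using linear_bounded_pos[OF lin] by (auto simp: mult.commute)
  have "(norm (G v))\<^sup>2 \<le> K * (v \<bullet> G v)" for v
  proof -
    have "G v \<bullet> G (G v) \<le> norm (G v) * norm (G (G v))" by (rule norm_cauchy_schwarz)
    also have "\<dots> \<le> norm (G v) * (K * norm (G v))" by (intro mult_left_mono K) simp
    finally have le: "G v \<bullet> G (G v) \<le> K * (norm (G v))\<^sup>2"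
      by (simp add: power2_eq_square mult_ac)
    have "0 \<le> (v - (1/K) *\<^sub>R G v) \<bullet> G (v - (1/K) *\<^sub>R G v)"
      by (rule pos_semidef_nonneg[OF G])
    also have "\<dots> = v \<bullet> G v - 2 / K * (norm (G v))\<^sup>2 + (1/K)\<^sup>2 * (G v \<bullet> G (G v))"
      using pos_semidef_sym[OF G, of v "G v"] unfolding power2_norm_eq_inner
      by (simp add: linear_diff[OF lin] linear_cmul[OF lin] inner_diff_left inner_diff_right
          diff_divide_distrib power2_eq_square)
    also have "\<dots> \<le> v \<bullet> G v - 2 / K * (norm (G v))\<^sup>2 + (1/K)\<^sup>2 * (K * (norm (G v))\<^sup>2)"
      by (intro add_left_mono mult_left_mono le) simp
    also have "\<dots> = v \<bullet> G v - (norm (G v))\<^sup>2 / K"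
      using K(1) by (simp add: field_simps power2_eq_square)
    finally show ?thesis using K(1) by (simp add: field_simps)
  qed
  with K(1) show thesis by (rule that)
qed

lemma tendsto_0_squeeze:
  fixes u w :: "nat \<Rightarrow> real"
  assumes "w \<longlonglongrightarrow> 0" and "\<And>k. 0 \<le> u k" and "\<And>k. u k \<le> w k"
  shows "u \<longlonglongrightarrow> 0"
  by (rule tendsto_sandwich[OF always_eventually always_eventually tendsto_const assms(1)])
    (use assms(2,3) in auto)

lemma pos_semidef_tendsto_0:
  assumes G: "pos_semidef G" and lim: "(\<lambda>k. v k \<bullet> G (v k)) \<longlonglongrightarrow> 0"
  shows "(\<lambda>k. G (v k)) \<longlonglongrightarrow> 0"
proof -
  obtain K where K: "\<And>v. (norm (G v))\<^sup>2 \<le> K * (v \<bullet> G v)"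
    using pos_semidef_norm_bound[OF G] by blast
  have "(\<lambda>k. K * (v k \<bullet> G (v k))) \<longlonglongrightarrow> 0" by (rule tendsto_mult_right_zero[OF lim])
  then have "(\<lambda>k. (norm (G (v k)))\<^sup>2) \<longlonglongrightarrow> 0"
    by (rule tendsto_0_squeeze) (simp_all add: K)
  then show ?thesis by (simp add: tendsto_norm_zero_iff)
qed

lemma pos_def_coercive:
  fixes G :: "'a::euclidean_space \<Rightarrow> 'a"
  assumes G: "pos_def G"
  obtains \<mu> where "\<mu> > 0" and "\<And>v. \<mu> * (norm v)\<^sup>2 \<le> v \<bullet> G v"
proof -
  have lin: "linear G" using G by (simp add: pos_def_def self_adjoint_def)
  have "continuous_on (sphere 0 1) G"
    by (rule linear_continuous_on) (simp add: linear_linear lin)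
  then have cont: "continuous_on (sphere 0 1) (\<lambda>v. v \<bullet> G v)"
    by (rule continuous_on_inner[OF continuous_on_id])
  have "(SOME b. b \<in> Basis) \<in> sphere (0::'a) 1" by (simp add: norm_Basis SOME_Basis)
  then have "sphere (0::'a) 1 \<noteq> {}" by blast
  from continuous_attains_inf[OF compact_sphere this cont]
  obtain u where u: "u \<in> sphere 0 1" "\<And>v. v \<in> sphere 0 1 \<Longrightarrow> u \<bullet> G u \<le> v \<bullet> G v"
    by blast
  have "u \<bullet> G u * (norm v)\<^sup>2 \<le> v \<bullet> G v" for v
  proof (cases "v = 0")
    case False
    define e where "e = inverse (norm v) *\<^sub>R v"
    have v: "v = norm v *\<^sub>R e" and "e \<in> sphere 0 1" using False by (auto simp: e_def)
    have "v \<bullet> G v = (e \<bullet> G e) * (norm v)\<^sup>2"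
      using arg_cong[OF v, of "\<lambda>v. v \<bullet> G v"]
      by (simp add: linear_cmul[OF lin] power2_eq_square mult.commute)
    then show ?thesis
      using u(2)[OF \<open>e \<in> sphere 0 1\<close>] by (metis mult_right_mono zero_le_power2)
  qed simp
  moreover have "u \<noteq> 0" using u(1) by auto
  then have "u \<bullet> G u > 0" using G by (simp add: pos_def_def)
  ultimately show thesis using that by blast
qed

text \<open>The objectives of both subproblems are of this form; the shift \<open>e\<close> collects everything that
  the subproblem treats as constant inside the penalty, and the subgradient is the negative gradient
  of the quadratic part at \<open>u\<close>.\<close>
lemma proximal_step_subgradient:
  fixes A :: "'x::euclidean_space \<Rightarrow> 'y::euclidean_space"
  assumes h: "closed_proper_convex_on UNIV h" and A: "linear A" and S: "pos_semidef S"
    and min: "is_arg_min (\<lambda>v. h v + ereal (- (a \<bullet> v) + \<sigma> / 2 * (norm (adjoint A v + e))\<^sup>2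
                 + 1 / 2 * (op_norm S (v - v0))\<^sup>2)) (\<lambda>_. True) u"
  shows "a - \<sigma> *\<^sub>R A (adjoint A u + e) - S (u - v0) \<in> subdifferential h u"
proof -
  define l where "l = - a + \<sigma> *\<^sub>R A (adjoint A u + e) + S (u - v0)"
  have linA: "linear (adjoint A)" by (rule adjoint_linear[OF A])
  have linS: "linear S" by (rule pos_semidef_linear[OF S])
  have "- l \<in> subdifferential h u"
  proof (rule minimizer_plus_quadratic_subgradient[OF h min])
    fix d :: 'y and t :: real
    have 1: "(norm (adjoint A (u + t *\<^sub>R d) + e))\<^sup>2
       = (norm (adjoint A u + e))\<^sup>2 + 2 * t * (A (adjoint A u + e) \<bullet> d) + t\<^sup>2 * (norm (adjoint A d))\<^sup>2"
    proof -
      have "adjoint A (u + t *\<^sub>R d) + e = (adjoint A u + e) + t *\<^sub>R adjoint A d"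
        by (simp add: linear_add[OF linA] linear_cmul[OF linA])
      moreover have "A (adjoint A u + e) \<bullet> d = (adjoint A u + e) \<bullet> adjoint A d"
        by (simp add: adjoint_works[OF A])
      ultimately show ?thesis
        by (simp only: power2_norm_eq_inner)
          (simp add: inner_add_left inner_add_right inner_commute power2_eq_square algebra_simps)
    qed
    have 2: "(op_norm S (u + t *\<^sub>R d - v0))\<^sup>2
       = (op_norm S (u - v0))\<^sup>2 + 2 * t * (S (u - v0) \<bullet> d) + t\<^sup>2 * (op_norm S d)\<^sup>2"
    proof -
      have e: "u + t *\<^sub>R d - v0 = (u - v0) + t *\<^sub>R d" by simp
      show ?thesis
        unfolding op_norm_square[OF S] e linear_add[OF linS] linear_cmul[OF linS]
        using pos_semidef_sym[OF S, of "u - v0" d]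
        by (simp add: inner_add_left inner_add_right inner_commute[of "S (u - v0)"]
            power2_eq_square algebra_simps)
    qed
    show "- (a \<bullet> (u + t *\<^sub>R d)) + \<sigma> / 2 * (norm (adjoint A (u + t *\<^sub>R d) + e))\<^sup>2
            + 1 / 2 * (op_norm S (u + t *\<^sub>R d - v0))\<^sup>2
        = - (a \<bullet> u) + \<sigma> / 2 * (norm (adjoint A u + e))\<^sup>2 + 1 / 2 * (op_norm S (u - v0))\<^sup>2
            + t * (l \<bullet> d) + t\<^sup>2 * (\<sigma> / 2 * (norm (adjoint A d))\<^sup>2 + 1 / 2 * (op_norm S d)\<^sup>2)"
      unfolding 1 2 l_def by (simp add: inner_add_left inner_add_right algebra_simps)
  qed
  then show ?thesis by (simp add: l_def algebra_simps)
qed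

section \<open>Energy analysis of the iterates\<close>

subsection \<open>Optimality conditions of the two steps\<close>

locale sPGADMM_iterates =
  fixes A :: "'x::euclidean_space \<Rightarrow> 'y::euclidean_space"
    and B :: "'x \<Rightarrow> 'z::euclidean_space"
    and c :: 'x
    and f :: "'y \<Rightarrow> ereal" and g :: "'z \<Rightarrow> ereal"
    and \<Sigma>f S :: "'y \<Rightarrow> 'y"
    and \<Sigma>g T :: "'z \<Rightarrow> 'z"
    and \<sigma> \<rho> :: real
    and y :: "nat \<Rightarrow> 'y" and z :: "nat \<Rightarrow> 'z" and x :: "nat \<Rightarrow> 'x"
  assumes A: "linear A" and B: "linear B"
    and f: "closed_proper_convex_on UNIV f" and g: "closed_proper_convex_on UNIV g"
    and \<Sigma>f: "pos_semidef \<Sigma>f" "monotone_modulus f \<Sigma>f"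
    and \<Sigma>g: "pos_semidef \<Sigma>g" "monotone_modulus g \<Sigma>g"
    and \<rho>: "0 < \<rho>" "\<rho> < 2" and \<sigma>: "0 < \<sigma>"
    and S: "pos_semidef S" and T: "pos_semidef T"
    and pos_y: "pos_def (\<lambda>v. \<Sigma>f v + S v + \<sigma> *\<^sub>R A (adjoint A v))"
    and pos_z: "pos_def (\<lambda>w. \<Sigma>g w + T w + \<sigma> *\<^sub>R B (adjoint B w))"
    and seq: "sPGADMM_sequence f g A B c \<sigma> \<rho> S T y z x"
begin

definition residual :: "nat \<Rightarrow> 'x" where
  "residual k = adjoint A (y (Suc k)) + adjoint B (z k) - c"

lemma x_step: "x (Suc k) = x k - \<sigma> *\<^sub>R (\<rho> *\<^sub>R residual k + adjoint B (z (Suc k) - z k))"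
  using seq by (simp add: sPGADMM_sequence_def residual_def)

lemma y_step_subgradient:
  "A (x k - \<sigma> *\<^sub>R residual k) - S (y (Suc k) - y k) \<in> subdifferential f (y (Suc k))"
proof -
  have "A (x k) - \<sigma> *\<^sub>R A (adjoint A (y (Suc k)) + (adjoint B (z k) - c)) - S (y (Suc k) - y k)
      \<in> subdifferential f (y (Suc k))"
    using seq by (intro proximal_step_subgradient f A S)
      (simp add: sPGADMM_sequence_def add_diff_eq)
  then show ?thesis
    by (simp add: residual_def linear_diff[OF A] linear_cmul[OF A] add_diff_eq)
qed

lemma z_step_subgradient:
  "B (x (Suc k)) - T (z (Suc k) - z k) \<in> subdifferential g (z (Suc k))"
proof -
  have e: "\<rho> *\<^sub>R residual k + adjoint B (w - z k)
      = adjoint B w + (\<rho> *\<^sub>R residual k - adjoint B (z k))" for w k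
    by (simp add: linear_diff[OF adjoint_linear[OF B]])
  have "B (x k) - \<sigma> *\<^sub>R B (adjoint B (z (Suc k)) + (\<rho> *\<^sub>R residual k - adjoint B (z k)))
      - T (z (Suc k) - z k) \<in> subdifferential g (z (Suc k))"
    using seq unfolding sPGADMM_sequence_def residual_def[symmetric] e
    by (intro proximal_step_subgradient g B T) blast
  then show ?thesis
    unfolding x_step e by (simp add: linear_diff[OF B] linear_cmul[OF B])
qed

subsection \<open>Decrease of the energy\<close>

text \<open>The point \<open>x + \<sigma> B\<^sup>* z\<close> is the variable of the relaxed Douglas-Rachford iteration behind the
  method: by \<open>shadow_step\<close> one step moves it by exactly \<open>- \<sigma> \<rho>\<close> times the residual. The error is
  read at index \<open>Suc k\<close> since the optimality condition of the \<open>z\<close>-step holds for \<open>z (Suc k)\<close> and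
  later iterates only.\<close>
definition shadow :: "'z \<Rightarrow> 'x \<Rightarrow> nat \<Rightarrow> 'x" where
  "shadow zb xb k = (x (Suc k) - xb) + \<sigma> *\<^sub>R adjoint B (z (Suc k) - zb)"

lemma shadow_step: "shadow zb xb (Suc k) = shadow zb xb k - (\<sigma> * \<rho>) *\<^sub>R residual (Suc k)"
  unfolding shadow_def x_step[of "Suc k"]
  by (simp add: linear_diff[OF adjoint_linear[OF B]] algebra_simps)

definition energy :: "'y \<Rightarrow> 'z \<Rightarrow> 'x \<Rightarrow> nat \<Rightarrow> real" where
  "energy yb zb xb k = (norm (shadow zb xb k))\<^sup>2 / (\<sigma> * \<rho>)
     + (y (Suc k) - yb) \<bullet> S (y (Suc k) - yb) + (z k - zb) \<bullet> T (z k - zb)"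

definition energy_drop :: "'y \<Rightarrow> 'z \<Rightarrow> nat \<Rightarrow> real" where
  "energy_drop yb zb k = \<sigma> * (2 - \<rho>) * (norm (residual (Suc k)))\<^sup>2
     + (y (Suc (Suc k)) - y (Suc k)) \<bullet> S (y (Suc (Suc k)) - y (Suc k))
     + (z (Suc k) - z k) \<bullet> T (z (Suc k) - z k)
     + 2 * ((y (Suc (Suc k)) - yb) \<bullet> \<Sigma>f (y (Suc (Suc k)) - yb))
     + 2 * ((z (Suc k) - zb) \<bullet> \<Sigma>g (z (Suc k) - zb))"

lemma energy_nonneg: "0 \<le> energy yb zb xb k"
  using \<sigma> \<rho> by (simp add: energy_def pos_semidef_nonneg[OF S] pos_semidef_nonneg[OF T])

lemma energy_drop_bounds:
  shows "\<sigma> * (2 - \<rho>) * (norm (residual (Suc k)))\<^sup>2 \<le> energy_drop yb zb k"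
    and "(y (Suc (Suc k)) - y (Suc k)) \<bullet> S (y (Suc (Suc k)) - y (Suc k)) \<le> energy_drop yb zb k"
    and "(z (Suc k) - z k) \<bullet> T (z (Suc k) - z k) \<le> energy_drop yb zb k"
    and "(y (Suc (Suc k)) - yb) \<bullet> \<Sigma>f (y (Suc (Suc k)) - yb) \<le> energy_drop yb zb k"
    and "(z (Suc k) - zb) \<bullet> \<Sigma>g (z (Suc k) - zb) \<le> energy_drop yb zb k"
proof -
  have "0 \<le> \<sigma> * (2 - \<rho>) * (norm (residual (Suc k)))\<^sup>2" using \<sigma> \<rho> by simp
  note nn = this pos_semidef_nonneg[OF S, of "y (Suc (Suc k)) - y (Suc k)"]
    pos_semidef_nonneg[OF T, of "z (Suc k) - z k"]
    pos_semidef_nonneg[OF \<Sigma>f(1), of "y (Suc (Suc k)) - yb"]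
    pos_semidef_nonneg[OF \<Sigma>g(1), of "z (Suc k) - zb"]
  show "\<sigma> * (2 - \<rho>) * (norm (residual (Suc k)))\<^sup>2 \<le> energy_drop yb zb k"
    and "(y (Suc (Suc k)) - y (Suc k)) \<bullet> S (y (Suc (Suc k)) - y (Suc k)) \<le> energy_drop yb zb k"
    and "(z (Suc k) - z k) \<bullet> T (z (Suc k) - z k) \<le> energy_drop yb zb k"
    and "(y (Suc (Suc k)) - yb) \<bullet> \<Sigma>f (y (Suc (Suc k)) - yb) \<le> energy_drop yb zb k"
    and "(z (Suc k) - zb) \<bullet> \<Sigma>g (z (Suc k) - zb) \<le> energy_drop yb zb k"
    using nn unfolding energy_drop_def by linarith+
qed

lemma energy_drop_nonneg: "0 \<le> energy_drop yb zb k"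
  using pos_semidef_nonneg[OF S] energy_drop_bounds(2) by (rule order_trans)

context
  fixes yb zb xb
  assumes kkt: "(yb, zb, xb) \<in> KKT_points f g A B c"
begin

lemma KKT_y: "A xb \<in> subdifferential f yb"
  and KKT_z: "B xb \<in> subdifferential g zb"
  and KKT_feasible: "c = adjoint A yb + adjoint B zb"
  using kkt by (auto simp: KKT_points_def)

lemma y_step_monotone:
  "(y (Suc k) - yb) \<bullet> \<Sigma>f (y (Suc k) - yb) + S (y (Suc k) - y k) \<bullet> (y (Suc k) - yb)
     \<le> (x k - xb - \<sigma> *\<^sub>R residual k) \<bullet> adjoint A (y (Suc k) - yb)"
proof -
  have "(y (Suc k) - yb) \<bullet> \<Sigma>f (y (Suc k) - yb)
      \<le> (A (x k - \<sigma> *\<^sub>R residual k) - S (y (Suc k) - y k) - A xb) \<bullet> (y (Suc k) - yb)"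
    using \<Sigma>f(2) KKT_y y_step_subgradient[of k] subdifferential_in_edom[OF f]
    unfolding monotone_modulus_def op_norm_square[OF \<Sigma>f(1)] by blast
  also have "\<dots> = A (x k - xb - \<sigma> *\<^sub>R residual k) \<bullet> (y (Suc k) - yb)
      - S (y (Suc k) - y k) \<bullet> (y (Suc k) - yb)"
    by (simp add: linear_diff[OF A] inner_diff_left)
  finally show ?thesis by (simp add: adjoint_works[OF A])
qed

lemma z_step_monotone:
  "(z (Suc k) - zb) \<bullet> \<Sigma>g (z (Suc k) - zb) + T (z (Suc k) - z k) \<bullet> (z (Suc k) - zb)
     \<le> (x (Suc k) - xb) \<bullet> adjoint B (z (Suc k) - zb)"
proof -
  have "(z (Suc k) - zb) \<bullet> \<Sigma>g (z (Suc k) - zb)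
      \<le> (B (x (Suc k)) - T (z (Suc k) - z k) - B xb) \<bullet> (z (Suc k) - zb)"
    using \<Sigma>g(2) KKT_z z_step_subgradient[of k] subdifferential_in_edom[OF g]
    unfolding monotone_modulus_def op_norm_square[OF \<Sigma>g(1)] by blast
  also have "\<dots> = B (x (Suc k) - xb) \<bullet> (z (Suc k) - zb)
      - T (z (Suc k) - z k) \<bullet> (z (Suc k) - zb)"
    by (simp add: linear_diff[OF B] inner_diff_left)
  finally show ?thesis by (simp add: adjoint_works[OF B])
qed

lemma residual_eq: "residual k = adjoint A (y (Suc k) - yb) + adjoint B (z k - zb)"
  unfolding residual_def unfolding KKT_feasible
  by (simp add: linear_diff[OF adjoint_linear[OF A]] linear_diff[OF adjoint_linear[OF B]])

text \<open>Monotonicity is used for the \<open>y\<close>-step at \<open>Suc k\<close> but for the \<open>z\<close>-step at \<open>k\<close>: with this offset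
  the two right-hand sides add up to \<open>s \<bullet> r - \<sigma> |r|\<^sup>2\<close>, where \<open>s\<close> is the shadow error and \<open>r\<close> the
  residual, which is the inner product that governs \<open>|s - \<sigma> \<rho> r|\<^sup>2\<close>.\<close>
lemma energy_decrease: "energy yb zb xb (Suc k) \<le> energy yb zb xb k - energy_drop yb zb k"
proof -
  define a where "a = adjoint A (y (Suc (Suc k)) - yb)"
  define b where "b = adjoint B (z (Suc k) - zb)"
  define e where "e = x (Suc k) - xb"
  define r where "r = residual (Suc k)"
  define s where "s = shadow zb xb k"
  have r: "r = a + b" by (simp add: r_def a_def b_def residual_eq)
  define N where "N = (norm s)\<^sup>2 / (\<sigma> * \<rho>)"
  define N' where "N' = (norm (shadow zb xb (Suc k)))\<^sup>2 / (\<sigma> * \<rho>)"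
  define R where "R = \<sigma> * (2 - \<rho>) * (norm r)\<^sup>2"
  have s: "s = e + \<sigma> *\<^sub>R b" by (simp add: s_def shadow_def e_def b_def)
  have sum: "(e - \<sigma> *\<^sub>R r) \<bullet> a + e \<bullet> b = s \<bullet> r - \<sigma> * (norm r)\<^sup>2"
    unfolding s power2_norm_eq_inner r
    by (simp add: inner_add_left inner_add_right inner_diff_left inner_commute algebra_simps)
  have "(norm (shadow zb xb (Suc k)))\<^sup>2 = (norm s)\<^sup>2 - 2 * (\<sigma> * \<rho>) * (s \<bullet> r) + (\<sigma> * \<rho>)\<^sup>2 * (norm r)\<^sup>2"
    unfolding shadow_step s_def[symmetric] r_def[symmetric] power2_norm_eq_inner
    by (simp add: inner_diff_left inner_diff_right inner_commute power2_eq_square algebra_simps)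
  then have "(norm (shadow zb xb (Suc k)))\<^sup>2 / (\<sigma> * \<rho>)
      = (norm s)\<^sup>2 / (\<sigma> * \<rho>) - 2 * (s \<bullet> r) + \<sigma> * \<rho> * (norm r)\<^sup>2"
    using \<sigma> \<rho> by (simp add: field_simps power2_eq_square)
  also have "\<dots> = (norm s)\<^sup>2 / (\<sigma> * \<rho>) - \<sigma> * (2 - \<rho>) * (norm r)\<^sup>2
      - 2 * ((e - \<sigma> *\<^sub>R r) \<bullet> a + e \<bullet> b)"
    unfolding sum by (simp add: algebra_simps)
  finally have "N' = N - R - 2 * ((e - \<sigma> *\<^sub>R r) \<bullet> a + e \<bullet> b)"
    unfolding N_def N'_def R_def .
  moreover have "2 * (S (y (Suc (Suc k)) - y (Suc k)) \<bullet> (y (Suc (Suc k)) - yb))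
      = (y (Suc (Suc k)) - yb) \<bullet> S (y (Suc (Suc k)) - yb) - (y (Suc k) - yb) \<bullet> S (y (Suc k) - yb)
        + (y (Suc (Suc k)) - y (Suc k)) \<bullet> S (y (Suc (Suc k)) - y (Suc k))"
    using pos_semidef_three_point[OF S, of "y (Suc (Suc k)) - yb" "y (Suc k) - yb"] by simp
  moreover have "2 * (T (z (Suc k) - z k) \<bullet> (z (Suc k) - zb))
      = (z (Suc k) - zb) \<bullet> T (z (Suc k) - zb) - (z k - zb) \<bullet> T (z k - zb)
        + (z (Suc k) - z k) \<bullet> T (z (Suc k) - z k)"
    using pos_semidef_three_point[OF T, of "z (Suc k) - zb" "z k - zb"] by simp
  ultimately show ?thesis
    using y_step_monotone[of "Suc k"] z_step_monotone[of k]
    unfolding energy_def energy_drop_def a_def[symmetric] b_def[symmetric] e_def[symmetric]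
      r_def[symmetric] s_def[symmetric] N_def[symmetric] N'_def[symmetric] R_def[symmetric]
    by argo
qed

lemma energy_drop_le: "energy_drop yb zb k \<le> energy yb zb xb k"
  using energy_decrease[of k] energy_nonneg[of yb zb xb "Suc k"] by linarith

lemma energy_decseq: "decseq (energy yb zb xb)"
proof (rule decseq_SucI)
  show "energy yb zb xb (Suc k) \<le> energy yb zb xb k" for k
    using energy_decrease[of k] energy_drop_nonneg[of yb zb k] by linarith
qed

lemma energy_convergent: "convergent (energy yb zb xb)"
proof -
  have "\<forall>k. 0 \<le> energy yb zb xb k" using energy_nonneg by blast
  from decseq_convergent[OF energy_decseq this] show ?thesis by (auto intro: convergentI)
qed

lemma energy_drop_tendsto_0: "energy_drop yb zb \<longlonglongrightarrow> 0"
proof -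
  obtain L where L: "energy yb zb xb \<longlonglongrightarrow> L"
    using energy_convergent by (auto simp: convergent_def)
  have "(\<lambda>k. energy yb zb xb k - energy yb zb xb (Suc k)) \<longlonglongrightarrow> 0"
    using tendsto_diff[OF L LIMSEQ_Suc[OF L]] by simp
  then show ?thesis
  proof (rule tendsto_0_squeeze)
    show "0 \<le> energy_drop yb zb k" for k by (rule energy_drop_nonneg)
    show "energy_drop yb zb k \<le> energy yb zb xb k - energy yb zb xb (Suc k)" for k
      using energy_decrease[of k] by linarith
  qed
qed

subsection \<open>The energy dominates the errors\<close>

text \<open>The shadow error is a sum of two vectors whose inner product is, by monotonicity of the
  \<open>z\<close>-step, nonnegative up to a term that the \<open>T\<close>-part of the energy absorbs. So the energy
  controls both summands, not just their sum.\<close>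
lemma x_z_error_le_energy:
  "(norm (x (Suc k) - xb))\<^sup>2 + \<sigma>\<^sup>2 * (norm (adjoint B (z (Suc k) - zb)))\<^sup>2
     \<le> (\<sigma> * \<rho> + \<sigma>) * energy yb zb xb k"
proof -
  define b where "b = adjoint B (z (Suc k) - zb)"
  define e where "e = x (Suc k) - xb"
  have "2 * (T (z (Suc k) - z k) \<bullet> (z (Suc k) - zb))
      = (z (Suc k) - zb) \<bullet> T (z (Suc k) - zb) - (z k - zb) \<bullet> T (z k - zb)
        + (z (Suc k) - z k) \<bullet> T (z (Suc k) - z k)"
    using pos_semidef_three_point[OF T, of "z (Suc k) - zb" "z k - zb"] by simp
  then have "- ((z k - zb) \<bullet> T (z k - zb)) \<le> 2 * (e \<bullet> b)"
    using z_step_monotone[of k] pos_semidef_nonneg[OF T, of "z (Suc k) - zb"]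
      pos_semidef_nonneg[OF T, of "z (Suc k) - z k"] pos_semidef_nonneg[OF \<Sigma>g(1), of "z (Suc k) - zb"]
    unfolding e_def b_def by linarith
  then have 1: "\<sigma> * - ((z k - zb) \<bullet> T (z k - zb)) \<le> \<sigma> * (2 * (e \<bullet> b))"
    using \<sigma> by (intro mult_left_mono) auto
  have 2: "(norm (shadow zb xb k))\<^sup>2 = (norm e)\<^sup>2 + \<sigma>\<^sup>2 * (norm b)\<^sup>2 + \<sigma> * (2 * (e \<bullet> b))"
    unfolding shadow_def e_def[symmetric] b_def[symmetric] power2_norm_eq_inner
    by (simp add: inner_add_left inner_add_right inner_commute power2_eq_square algebra_simps)
  have "(norm (shadow zb xb k))\<^sup>2 / (\<sigma> * \<rho>) \<le> energy yb zb xb k"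
    unfolding energy_def
    using pos_semidef_nonneg[OF T, of "z k - zb"] pos_semidef_nonneg[OF S, of "y (Suc k) - yb"] by linarith
  then have 3: "(norm (shadow zb xb k))\<^sup>2 \<le> \<sigma> * \<rho> * energy yb zb xb k"
    using \<sigma> \<rho> by (simp add: field_simps)
  have "0 \<le> (norm (shadow zb xb k))\<^sup>2 / (\<sigma> * \<rho>)" using \<sigma> \<rho> by simp
  then have "(z k - zb) \<bullet> T (z k - zb) \<le> energy yb zb xb k"
    unfolding energy_def using pos_semidef_nonneg[OF S, of "y (Suc k) - yb"] by linarith
  then have "\<sigma> * ((z k - zb) \<bullet> T (z k - zb)) \<le> \<sigma> * energy yb zb xb k"
    using \<sigma> by (intro mult_left_mono) auto
  with 1 2 3 show ?thesis
    unfolding e_def[symmetric] b_def[symmetric] by (simp add: algebra_simps)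
qed

text \<open>Each of the three summands of the positive definite operators is controlled by the energy:
  the moduli through the energy drop, the proximal terms directly, and the images under the adjoints
  through the bound above and the residual.\<close>
lemma error_le_energy:
  obtains K where "\<And>k. (norm (y (Suc (Suc k)) - yb))\<^sup>2 \<le> K * energy yb zb xb k"
    and "\<And>k. (norm (z (Suc k) - zb))\<^sup>2 \<le> K * energy yb zb xb k"
    and "\<And>k. (norm (x (Suc k) - xb))\<^sup>2 \<le> K * energy yb zb xb k"
proof -
  obtain \<mu> where \<mu>: "\<mu> > 0"
    "\<And>v. \<mu> * (norm v)\<^sup>2 \<le> v \<bullet> (\<Sigma>f v + S v + \<sigma> *\<^sub>R A (adjoint A v))"
    using pos_def_coercive[OF pos_y] by blast
  obtain \<nu> where \<nu>: "\<nu> > 0"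
    "\<And>w. \<nu> * (norm w)\<^sup>2 \<le> w \<bullet> (\<Sigma>g w + T w + \<sigma> *\<^sub>R B (adjoint B w))"
    using pos_def_coercive[OF pos_z] by blast
  define E where "E = energy yb zb xb"
  have E0: "0 \<le> E k" for k by (simp add: E_def energy_nonneg)
  have ES: "E (Suc k) \<le> E k" for k
    using energy_decseq by (simp add: E_def decseq_Suc_iff)
  define Kx where "Kx = \<sigma> * \<rho> + \<sigma>"
  define Kz where "Kz = (2 + Kx / \<sigma>) / \<nu>"
  define Ky where "Ky = (2 + 2 / (2 - \<rho>) + 2 * (Kx / \<sigma>)) / \<mu>"
  have pos: "Kx > 0" "Kz > 0" "Ky > 0"
    using \<sigma> \<rho> \<mu>(1) \<nu>(1) by (auto simp: Kx_def Kz_def Ky_def intro!: divide_pos_pos add_pos_pos mult_pos_pos)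
  have xz: "(norm (x (Suc k) - xb))\<^sup>2 + \<sigma>\<^sup>2 * (norm (adjoint B (z (Suc k) - zb)))\<^sup>2 \<le> Kx * E k" for k
    unfolding Kx_def E_def by (rule x_z_error_le_energy)
  have x: "(norm (x (Suc k) - xb))\<^sup>2 \<le> Kx * E k" for k
  proof -
    have "0 \<le> \<sigma>\<^sup>2 * (norm (adjoint B (z (Suc k) - zb)))\<^sup>2" by simp
    then show ?thesis using xz[of k] by linarith
  qed
  have b: "\<sigma> * (norm (adjoint B (z (Suc k) - zb)))\<^sup>2 \<le> Kx / \<sigma> * E k" for k
  proof -
    have "\<sigma>\<^sup>2 * (norm (adjoint B (z (Suc k) - zb)))\<^sup>2 \<le> Kx * E k"
      using xz[of k] zero_le_power2[of "norm (x (Suc k) - xb)"] by linarith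
    then show ?thesis using \<sigma> by (simp add: field_simps power2_eq_square)
  qed
  have parts: "(y (Suc k) - yb) \<bullet> S (y (Suc k) - yb) \<le> E k" "(z k - zb) \<bullet> T (z k - zb) \<le> E k" for k
  proof -
    have "0 \<le> (norm (shadow zb xb k))\<^sup>2 / (\<sigma> * \<rho>)" using \<sigma> \<rho> by simp
    then show "(y (Suc k) - yb) \<bullet> S (y (Suc k) - yb) \<le> E k" "(z k - zb) \<bullet> T (z k - zb) \<le> E k"
      unfolding E_def energy_def
      using pos_semidef_nonneg[OF S, of "y (Suc k) - yb"] pos_semidef_nonneg[OF T, of "z k - zb"]
      by linarith+
  qed
  note drop = order_trans[OF energy_drop_bounds(1) energy_drop_le]
    order_trans[OF energy_drop_bounds(4) energy_drop_le]
    order_trans[OF energy_drop_bounds(5) energy_drop_le]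
  have z: "(norm (z (Suc k) - zb))\<^sup>2 \<le> Kz * E k" for k
  proof -
    have "\<nu> * (norm (z (Suc k) - zb))\<^sup>2 \<le> (z (Suc k) - zb) \<bullet> \<Sigma>g (z (Suc k) - zb)
        + (z (Suc k) - zb) \<bullet> T (z (Suc k) - zb) + \<sigma> * (norm (adjoint B (z (Suc k) - zb)))\<^sup>2"
      using \<nu>(2)[of "z (Suc k) - zb"]
      by (simp add: inner_add_right power2_norm_eq_inner adjoint_works[OF B] inner_commute[of _ "B _"])
    also have "\<dots> \<le> E k + E k + Kx / \<sigma> * E k"
      using drop(3)[of k] parts(2)[of "Suc k"] ES[of k] b[of k] unfolding E_def by linarith
    finally show ?thesis using \<nu>(1) by (simp add: Kz_def field_simps)
  qed
  have y: "(norm (y (Suc (Suc k)) - yb))\<^sup>2 \<le> Ky * E k" for k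
  proof -
    have "adjoint A (y (Suc (Suc k)) - yb) = residual (Suc k) - adjoint B (z (Suc k) - zb)"
      by (simp add: residual_eq)
    then have "(norm (adjoint A (y (Suc (Suc k)) - yb)))\<^sup>2
        \<le> (norm (residual (Suc k)) + norm (adjoint B (z (Suc k) - zb)))\<^sup>2"
      by (metis norm_triangle_ineq4 norm_ge_zero power_mono)
    also have "\<dots> \<le> 2 * (norm (residual (Suc k)))\<^sup>2 + 2 * (norm (adjoint B (z (Suc k) - zb)))\<^sup>2"
      using sum_squares_bound[of "norm (residual (Suc k))" "norm (adjoint B (z (Suc k) - zb))"]
      by (simp add: power2_sum)
    finally have "\<sigma> * (norm (adjoint A (y (Suc (Suc k)) - yb)))\<^sup>2
        \<le> \<sigma> * (2 * (norm (residual (Suc k)))\<^sup>2 + 2 * (norm (adjoint B (z (Suc k) - zb)))\<^sup>2)"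
      using \<sigma> by (intro mult_left_mono) auto
    moreover have "\<sigma> * (norm (residual (Suc k)))\<^sup>2 \<le> 1 / (2 - \<rho>) * E k"
      using drop(1)[of k] \<rho> unfolding E_def by (simp add: field_simps)
    ultimately have a: "\<sigma> * (norm (adjoint A (y (Suc (Suc k)) - yb)))\<^sup>2
        \<le> 2 * (1 / (2 - \<rho>) * E k) + 2 * (Kx / \<sigma> * E k)"
      using b[of k] by (simp only: distrib_left)
    have "\<mu> * (norm (y (Suc (Suc k)) - yb))\<^sup>2 \<le> (y (Suc (Suc k)) - yb) \<bullet> \<Sigma>f (y (Suc (Suc k)) - yb)
        + (y (Suc (Suc k)) - yb) \<bullet> S (y (Suc (Suc k)) - yb)
        + \<sigma> * (norm (adjoint A (y (Suc (Suc k)) - yb)))\<^sup>2"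
      using \<mu>(2)[of "y (Suc (Suc k)) - yb"]
      by (simp add: inner_add_right power2_norm_eq_inner adjoint_works[OF A] inner_commute[of _ "A _"])
    also have "\<dots> \<le> E k + E k + (2 * (1 / (2 - \<rho>) * E k) + 2 * (Kx / \<sigma> * E k))"
      using drop(2)[of k] parts(1)[of "Suc k"] ES[of k] a unfolding E_def by linarith
    also have "\<dots> = (\<mu> * Ky) * E k"
    proof -
      have "\<mu> * Ky = 2 + 2 / (2 - \<rho>) + 2 * (Kx / \<sigma>)" using \<mu>(1) by (simp add: Ky_def)
      then show ?thesis by (simp add: distrib_right)
    qed
    finally show ?thesis using \<mu>(1) by simp
  qed
  define K where "K = Kx + Ky + Kz"
  have "Kx \<le> K" "Ky \<le> K" "Kz \<le> K" using pos by (auto simp: K_def)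
  then have "Kx * E k \<le> K * E k" "Ky * E k \<le> K * E k" "Kz * E k \<le> K * E k" for k
    using E0 by (auto intro: mult_right_mono)
  with x y z show thesis
    unfolding E_def by (intro that[of K]) (blast intro: order_trans)+
qed

lemma energy_tendsto_0_imp_convergence:
  assumes "energy yb zb xb \<longlonglongrightarrow> 0"
  shows "y \<longlonglongrightarrow> yb" and "z \<longlonglongrightarrow> zb" and "x \<longlonglongrightarrow> xb"
proof -
  obtain K where K: "\<And>k. (norm (y (Suc (Suc k)) - yb))\<^sup>2 \<le> K * energy yb zb xb k"
    "\<And>k. (norm (z (Suc k) - zb))\<^sup>2 \<le> K * energy yb zb xb k"
    "\<And>k. (norm (x (Suc k) - xb))\<^sup>2 \<le> K * energy yb zb xb k"
    using error_le_energy by blast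
  have lim: "v \<longlonglongrightarrow> vb" if "\<And>k. (norm (v k - vb))\<^sup>2 \<le> K * energy yb zb xb k"
    for v :: "nat \<Rightarrow> 'd::euclidean_space" and vb
  proof -
    have "(\<lambda>k. K * energy yb zb xb k) \<longlonglongrightarrow> 0" by (rule tendsto_mult_right_zero[OF assms])
    then have "(\<lambda>k. (norm (v k - vb))\<^sup>2) \<longlonglongrightarrow> 0"
      by (rule tendsto_0_squeeze) (use that in simp_all)
    then have "(\<lambda>k. v k - vb) \<longlonglongrightarrow> 0" by (simp add: tendsto_norm_zero_iff)
    then show ?thesis by (rule LIM_zero_cancel)
  qed
  show "y \<longlonglongrightarrow> yb"
    using lim[OF K(1)] filterlim_sequentially_Suc[of "\<lambda>k. y (Suc k)"] filterlim_sequentially_Suc[of y]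
    by simp
  show "z \<longlonglongrightarrow> zb" using lim[OF K(2)] filterlim_sequentially_Suc[of z] by simp
  show "x \<longlonglongrightarrow> xb" using lim[OF K(3)] filterlim_sequentially_Suc[of x] by simp
qed

lemma iterates_bounded: "bounded (range (\<lambda>k. (y (Suc (Suc k)), z (Suc k), x (Suc k))))"
proof -
  obtain K where K: "\<And>k. (norm (y (Suc (Suc k)) - yb))\<^sup>2 \<le> K * energy yb zb xb k"
    "\<And>k. (norm (z (Suc k) - zb))\<^sup>2 \<le> K * energy yb zb xb k"
    "\<And>k. (norm (x (Suc k) - xb))\<^sup>2 \<le> K * energy yb zb xb k"
    using error_le_energy by blast
  have bd: "bounded (range v)" if v: "\<And>k. (norm (v k - vb))\<^sup>2 \<le> K * energy yb zb xb k"
    for v :: "nat \<Rightarrow> 'd::euclidean_space" and vb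
  proof -
    have "norm (v k - vb) \<le> sqrt (\<bar>K\<bar> * energy yb zb xb 0)" for k
    proof (rule real_le_rsqrt)
      note v[of k]
      also have "K * energy yb zb xb k \<le> \<bar>K\<bar> * energy yb zb xb 0"
        using energy_decseq energy_nonneg by (intro mult_mono) (auto simp: decseq_def)
      finally show "(norm (v k - vb))\<^sup>2 \<le> \<bar>K\<bar> * energy yb zb xb 0" .
    qed
    then show ?thesis
      by (auto simp: bounded_any_center[of _ vb] dist_norm norm_minus_commute)
  qed
  have "bounded (range (\<lambda>k. y (Suc (Suc k))) \<times> range (\<lambda>k. z (Suc k)) \<times> range (\<lambda>k. x (Suc k)))"
    by (intro bounded_Times bd[OF K(1)] bd[OF K(2)] bd[OF K(3)])
  then show ?thesis by (rule bounded_subset) auto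
qed

subsection \<open>Cluster points\<close>

lemma residual_tendsto_0: "(\<lambda>k. residual (Suc k)) \<longlonglongrightarrow> 0"
proof -
  have "(\<lambda>k. energy_drop yb zb k / (\<sigma> * (2 - \<rho>))) \<longlonglongrightarrow> 0"
    using energy_drop_tendsto_0 by (rule tendsto_divide_zero)
  then have "(\<lambda>k. (norm (residual (Suc k)))\<^sup>2) \<longlonglongrightarrow> 0"
  proof (rule tendsto_0_squeeze)
    show "0 \<le> (norm (residual (Suc k)))\<^sup>2" for k by simp
    show "(norm (residual (Suc k)))\<^sup>2 \<le> energy_drop yb zb k / (\<sigma> * (2 - \<rho>))" for k
      using energy_drop_bounds(1)[of k yb zb] \<sigma> \<rho> by (simp add: field_simps)
  qed
  then show ?thesis by (simp add: tendsto_norm_zero_iff)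
qed

lemma S_increment_tendsto_0: "(\<lambda>k. S (y (Suc (Suc k)) - y (Suc k))) \<longlonglongrightarrow> 0"
  by (intro pos_semidef_tendsto_0[OF S] tendsto_0_squeeze[OF energy_drop_tendsto_0]
      energy_drop_bounds(2) pos_semidef_nonneg[OF S])

lemma T_increment_tendsto_0: "(\<lambda>k. T (z (Suc k) - z k)) \<longlonglongrightarrow> 0"
  by (intro pos_semidef_tendsto_0[OF T] tendsto_0_squeeze[OF energy_drop_tendsto_0]
      energy_drop_bounds(3) pos_semidef_nonneg[OF T])

lemma cluster_point_KKT:
  assumes \<phi>: "strict_mono \<phi>"
    and y: "(\<lambda>j. y (Suc (Suc (\<phi> j)))) \<longlonglongrightarrow> y'"
    and z: "(\<lambda>j. z (Suc (\<phi> j))) \<longlonglongrightarrow> z'"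
    and x: "(\<lambda>j. x (Suc (\<phi> j))) \<longlonglongrightarrow> x'"
  shows "(y', z', x') \<in> KKT_points f g A B c"
proof -
  have lim: "(\<lambda>j. F (v j)) \<longlonglongrightarrow> F v'" if "linear F" "v \<longlonglongrightarrow> v'"
    for F :: "'c::euclidean_space \<Rightarrow> 'd::euclidean_space" and v v'
    using that by (simp add: linear_linear bounded_linear.tendsto)
  note sub = LIMSEQ_subseq_LIMSEQ[OF _ \<phi>, unfolded comp_def]
  have "(\<lambda>j. A (x (Suc (\<phi> j)) - \<sigma> *\<^sub>R residual (Suc (\<phi> j))) - S (y (Suc (Suc (\<phi> j))) - y (Suc (\<phi> j))))
      \<longlonglongrightarrow> A (x' - \<sigma> *\<^sub>R 0) - 0"
    by (intro tendsto_diff tendsto_scaleR tendsto_const lim[OF A] x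
        sub[OF residual_tendsto_0] sub[OF S_increment_tendsto_0])
  then have 1: "A x' \<in> subdifferential f y'"
    using subdifferential_closed_graph[OF f y_step_subgradient y] by simp
  have "(\<lambda>j. B (x (Suc (\<phi> j))) - T (z (Suc (\<phi> j)) - z (\<phi> j))) \<longlonglongrightarrow> B x' - 0"
    by (intro tendsto_diff lim[OF B] x sub[OF T_increment_tendsto_0])
  then have 2: "B x' \<in> subdifferential g z'"
    using subdifferential_closed_graph[OF g z_step_subgradient z] by simp
  have "(\<lambda>j. residual (Suc (\<phi> j))) \<longlonglongrightarrow> adjoint A y' + adjoint B z' - c"
    unfolding residual_def
    by (intro tendsto_intros lim[OF adjoint_linear[OF A]] lim[OF adjoint_linear[OF B]] y z)
  then have "adjoint A y' + adjoint B z' - c = 0"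
    by (rule LIMSEQ_unique[OF _ sub[OF residual_tendsto_0]])
  with 1 2 show ?thesis by (simp add: KKT_points_def)
qed

text \<open>The energy around the cluster point is evaluated at \<open>Suc (\<phi> j)\<close>, where its proximal terms
  involve exactly the iterates that converge; the shadow error there differs from the one at \<open>\<phi> j\<close>
  by a multiple of the residual.\<close>
lemma energy_at_cluster_point_subseq:
  assumes \<phi>: "strict_mono \<phi>"
    and y: "(\<lambda>j. y (Suc (Suc (\<phi> j)))) \<longlonglongrightarrow> y'"
    and z: "(\<lambda>j. z (Suc (\<phi> j))) \<longlonglongrightarrow> z'"
    and x: "(\<lambda>j. x (Suc (\<phi> j))) \<longlonglongrightarrow> x'"
  shows "(\<lambda>j. energy y' z' x' (Suc (\<phi> j))) \<longlonglongrightarrow> 0"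
proof -
  have lin0: "(\<lambda>j. F (v j)) \<longlonglongrightarrow> 0" if "linear F" "v \<longlonglongrightarrow> 0"
    for F :: "'c::euclidean_space \<Rightarrow> 'd::euclidean_space" and v
    using that by (simp add: linear_linear bounded_linear.tendsto_zero)
  note y0 = LIM_zero[OF y] and z0 = LIM_zero[OF z] and x0 = LIM_zero[OF x]
  have r0: "(\<lambda>j. residual (Suc (\<phi> j))) \<longlonglongrightarrow> 0"
    using LIMSEQ_subseq_LIMSEQ[OF residual_tendsto_0 \<phi>] by (simp add: comp_def)
  have "(\<lambda>j. shadow z' x' (\<phi> j)) \<longlonglongrightarrow> 0 + \<sigma> *\<^sub>R 0"
    unfolding shadow_def
    by (rule tendsto_add[OF x0 tendsto_scaleR[OF tendsto_const lin0[OF adjoint_linear[OF B] z0]]])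
  then have "(\<lambda>j. shadow z' x' (\<phi> j) - (\<sigma> * \<rho>) *\<^sub>R residual (Suc (\<phi> j)))
      \<longlonglongrightarrow> (0 + \<sigma> *\<^sub>R 0) - (\<sigma> * \<rho>) *\<^sub>R 0"
    by (rule tendsto_diff[OF _ tendsto_scaleR[OF tendsto_const r0]])
  then have "(\<lambda>j. shadow z' x' (Suc (\<phi> j))) \<longlonglongrightarrow> 0"
    by (simp add: shadow_step)
  from tendsto_power[OF tendsto_norm[OF this], of 2]
  have "(\<lambda>j. (norm (shadow z' x' (Suc (\<phi> j))))\<^sup>2) \<longlonglongrightarrow> 0" by simp
  from tendsto_divide_zero[OF this, of "\<sigma> * \<rho>"]
  have 1: "(\<lambda>j. (norm (shadow z' x' (Suc (\<phi> j))))\<^sup>2 / (\<sigma> * \<rho>)) \<longlonglongrightarrow> 0" .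
  note 2 = tendsto_inner[OF y0 lin0[OF pos_semidef_linear[OF S] y0]]
    and 3 = tendsto_inner[OF z0 lin0[OF pos_semidef_linear[OF T] z0]]
  from tendsto_add[OF tendsto_add[OF 1 2] 3] show ?thesis
    by (simp add: energy_def)
qed

end

theorem iterates_converge_to_KKT:
  assumes "KKT_points f g A B c \<noteq> {}"
  obtains y' z' x' where "(y', z', x') \<in> KKT_points f g A B c"
    and "y \<longlonglongrightarrow> y'" and "z \<longlonglongrightarrow> z'" and "x \<longlonglongrightarrow> x'"
proof -
  obtain yb zb xb where kkt: "(yb, zb, xb) \<in> KKT_points f g A B c" using assms by auto
  obtain p \<phi> where \<phi>: "strict_mono \<phi>"
    and p: "((\<lambda>k. (y (Suc (Suc k)), z (Suc k), x (Suc k))) \<circ> \<phi>) \<longlonglongrightarrow> p"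
    using bounded_imp_convergent_subsequence[OF iterates_bounded[OF kkt]] by blast
  obtain y' z' x' where p': "p = (y', z', x')" by (cases p)
  have y: "(\<lambda>j. y (Suc (Suc (\<phi> j)))) \<longlonglongrightarrow> y'"
    and z: "(\<lambda>j. z (Suc (\<phi> j))) \<longlonglongrightarrow> z'"
    and x: "(\<lambda>j. x (Suc (\<phi> j))) \<longlonglongrightarrow> x'"
    using tendsto_fst[OF p] tendsto_fst[OF tendsto_snd[OF p]] tendsto_snd[OF tendsto_snd[OF p]]
    by (simp_all add: p' comp_def)
  have kkt': "(y', z', x') \<in> KKT_points f g A B c"
    by (rule cluster_point_KKT[OF kkt \<phi> y z x])
  obtain L where L: "energy y' z' x' \<longlonglongrightarrow> L"
    using energy_convergent[OF kkt'] by (auto simp: convergent_def)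
  have "(\<lambda>j. energy y' z' x' (Suc (\<phi> j))) \<longlonglongrightarrow> L"
    using LIMSEQ_subseq_LIMSEQ[OF LIMSEQ_Suc[OF L] \<phi>] by (simp add: comp_def)
  then have "L = 0"
    by (rule LIMSEQ_unique[OF _ energy_at_cluster_point_subseq[OF kkt \<phi> y z x]])
  then have "energy y' z' x' \<longlonglongrightarrow> 0" using L by simp
  from that[OF kkt' energy_tendsto_0_imp_convergence[OF kkt' this]] show thesis .
qed

end

section \<open>Convergence to primal and dual solutions\<close>

theorem theorem3p1:
  fixes A :: "'x::euclidean_space \<Rightarrow> 'y::euclidean_space"
    and B :: "'x \<Rightarrow> 'z::euclidean_space"
    and c :: 'x
    and m n :: nat
    and Y :: "nat \<Rightarrow> 'e1::euclidean_space set"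
    and Z :: "nat \<Rightarrow> 'e2::euclidean_space set"
    and pY :: "nat \<Rightarrow> 'y \<Rightarrow> 'e1"
    and pZ :: "nat \<Rightarrow> 'z \<Rightarrow> 'e2"
    and f :: "'y \<Rightarrow> ereal" and f1 :: "'e1 \<Rightarrow> ereal" and f2 :: "'y \<Rightarrow> real"
    and g :: "'z \<Rightarrow> ereal" and g1 :: "'e2 \<Rightarrow> ereal" and g2 :: "'z \<Rightarrow> real"
    and \<Sigma>f S :: "'y \<Rightarrow> 'y"
    and \<Sigma>g T :: "'z \<Rightarrow> 'z"
    and \<sigma> \<rho> :: real
    and y :: "nat \<Rightarrow> 'y" and z :: "nat \<Rightarrow> 'z" and x :: "nat \<Rightarrow> 'x"
  assumes "1 \<le> m" and "is_product_of m Y pY"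
    and "1 \<le> n" and "is_product_of n Z pZ"
    and "linear A" and "linear B"
    and "closed_proper_convex_on UNIV f"
    and "closed_proper_convex_on (Y 1) f1" and "convex_quadratic f2"
    and "\<And>v. f v = f1 (pY 1 v) + ereal (f2 v)"
    and "closed_proper_convex_on UNIV g"
    and "closed_proper_convex_on (Z 1) g1" and "convex_quadratic g2"
    and "\<And>w. g w = g1 (pZ 1 w) + ereal (g2 w)"
    and "pos_semidef \<Sigma>f" and "monotone_modulus f \<Sigma>f"
    and "pos_semidef \<Sigma>g" and "monotone_modulus g \<Sigma>g"
    and "0 < \<rho>" and "\<rho> < 2" and "0 < \<sigma>"
    and "pos_semidef S" and "pos_semidef T"
    and "KKT_points f g A B c \<noteq> {}"
    and "pos_def (\<lambda>v. \<Sigma>f v + S v + \<sigma> *\<^sub>R A (adjoint A v))"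
    and "pos_def (\<lambda>w. \<Sigma>g w + T w + \<sigma> *\<^sub>R B (adjoint B w))"
    and "sPGADMM_sequence f g A B c \<sigma> \<rho> S T y z x"
  shows "(\<exists>p. (\<lambda>k. (y k, z k)) \<longlonglongrightarrow> p \<and> primal_optimal f g A B c p) \<and>
         (\<exists>xbar. x \<longlonglongrightarrow> xbar \<and> dual_optimal f g A B c xbar)"
proof -
  interpret sPGADMM_iterates A B c f g \<Sigma>f S \<Sigma>g T \<sigma> \<rho> y z x
    by (intro sPGADMM_iterates.intro) (fact assms)+
  obtain y' z' x' where kkt: "(y', z', x') \<in> KKT_points f g A B c"
    and lim: "y \<longlonglongrightarrow> y'" "z \<longlonglongrightarrow> z'" "x \<longlonglongrightarrow> x'"
    by (rule iterates_converge_to_KKT[OF \<open>KKT_points f g A B c \<noteq> {}\<close>])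
  have "(\<lambda>k. (y k, z k)) \<longlonglongrightarrow> (y', z')" by (intro tendsto_Pair lim)
  moreover have "primal_optimal f g A B c (y', z')"
    by (rule KKT_imp_primal_optimal[OF f g A B kkt])
  moreover have "dual_optimal f g A B c x'"
    by (rule KKT_imp_dual_optimal[OF f g A B kkt])
  ultimately show ?thesis using lim(3) by (intro conjI exI)
qed

end
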